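(* Let $b\ge 2$, $k\ge 1$, $n\ge 1$ be integers, and let $N_k=b^{2^{k}}-1$. Assume that $\frac{n+1}{2}=2^q p$ with $p$ an odd positive integer and $q\ge 0$ an integer (in particular $n$ is odd), that $b\ge \binom{n}{\frac{n+1}{2}}$, and that $b=(4\ell+2)p+1$ for some integer $\ell\ge 0$. Then $N_k$ is a degree $n$ $b$-Niven number. In particular, for every odd degree $m\ge 1$, there exist infinitely many bases $b\ge 2$ for which there exist degree $m$ $b$-Niven numbers all of whose base $b$ digits are different from zero.
   Context: For an integer base $b\ge 2$ and a positive integer $N$, let $s_b(N)$ denote the sum of the base $b$ digits of $N$. A positive integer $N$ is a $b$-Niven number if $s_b(N)$ divides $N$. For an integer $m\ge 1$, a positive integer $N$ is a degree $m$ $b$-Niven number if both $N$ and $N^m$ are $b$-Niven numbers. *)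

theory Defs
  imports Complex_Main
begin

(* Base b digits of N, least significant first and without leading zeros; meaningful for
   b >= 2 only. The guard on b only serves to make the recursion terminate. *)
function base_digits :: "nat \<Rightarrow> nat \<Rightarrow> nat list" where
  "base_digits b N =
     (if b < 2 \<or> N = 0 then [] else N mod b # base_digits b (N div b))"
  by pat_completeness auto
termination
  by (relation "measure snd") auto

declare base_digits.simps [simp del]

lemma horner_sum_base_digits:
  assumes "2 \<le> b"
  shows "horner_sum id b (base_digits b N) = N"
  using assms
proof (induction b N rule: base_digits.induct)
  case (1 b N)
  show ?case
  proof (cases "N = 0")
    case True
    then show ?thesis
      by (simp add: base_digits.simps)
  next
    case False
    then have "base_digits b N = N mod b # base_digits b (N div b)"
      using 1 by (subst base_digits.simps) simp
    then show ?thesis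
      using 1 False by simp
  qed
qed

lemma base_digits_less:
  assumes "2 \<le> b" "d \<in> set (base_digits b N)"
  shows "d < b"
  using assms
proof (induction b N rule: base_digits.induct)
  case (1 b N)
  have "N \<noteq> 0"
    using 1(3) by (subst (asm) base_digits.simps) (auto split: if_splits)
  then have "base_digits b N = N mod b # base_digits b (N div b)"
    using 1 by (subst base_digits.simps) simp
  then show ?case
    using 1 \<open>N \<noteq> 0\<close> by auto
qed

lemma last_base_digits_nonzero:
  assumes "2 \<le> b" "0 < N"
  shows "base_digits b N \<noteq> []" "last (base_digits b N) \<noteq> 0"
proof -
  have "base_digits b N \<noteq> [] \<and> last (base_digits b N) \<noteq> 0"
    using assms
  proof (induction b N rule: base_digits.induct)
    case (1 b N)
    show ?case
    proof (cases "N < b")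
      case True
      then have "base_digits b N = [N]"
        using 1 by (simp add: base_digits.simps)
      then show ?thesis
        using 1 by simp
    next
      case False
      then have "0 < N div b"
        using 1 by (simp add: div_greater_zero_iff)
      moreover have "base_digits b N = N mod b # base_digits b (N div b)"
        using 1 by (subst base_digits.simps) simp
      ultimately show ?thesis
        using 1 by simp
    qed
  qed
  then show "base_digits b N \<noteq> []" "last (base_digits b N) \<noteq> 0"
    by blast+
qed

definition digit_sum :: "nat \<Rightarrow> nat \<Rightarrow> nat" where
  "digit_sum b N = sum_list (base_digits b N)"

definition niven :: "nat \<Rightarrow> nat \<Rightarrow> bool" where
  "niven b N \<longleftrightarrow> 0 < N \<and> digit_sum b N dvd N"

definition degree_niven :: "nat \<Rightarrow> nat \<Rightarrow> nat \<Rightarrow> bool" where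
  "degree_niven m b N \<longleftrightarrow> niven b N \<and> niven b (N ^ m)"

end

theory Submission
  imports Defs "HOL-Library.Infinite_Set"
begin

text \<open>
  Put \<open>B = b ^ 2 ^ k\<close>. Pairing consecutive terms of the binomial expansion of \<open>(B - 1) ^ n\<close> gives
  base \<open>B\<^sup>2\<close> blocks \<open>(n choose (2i + 1)) * B - (n choose 2i)\<close>, and the bound on \<open>b\<close> prevents carries
  except for the one borrow in each block. So a block has digit sum
  \<open>2 ^ k * (b - 1) + (n choose (2i + 1)) - (n choose 2i)\<close>; the binomial coefficients cancel in the
  total, which is \<open>2 ^ k * (b - 1) * ((n + 1) div 2)\<close>. Since \<open>b\<close> is odd, \<open>2 ^ k * (b - 1)\<close> divides
  \<open>B - 1\<close>, and the remaining factor \<open>2 ^ q * p\<close> divides \<open>(B - 1) ^ (n - 1)\<close>.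
\<close>

section \<open>Digit sums of shifted, complemented and concatenated numbers\<close>

lemma digit_sum_rec:
  assumes "2 \<le> b"
  shows "digit_sum b N = N mod b + digit_sum b (N div b)"
  using assms by (cases "N = 0")
    (simp_all add: digit_sum_def base_digits.simps[of b N] base_digits.simps[of b 0])

lemma digit_sum_0 [simp]: "digit_sum b 0 = 0"
  by (simp add: digit_sum_def base_digits.simps)

lemma digit_sum_less_base:
  assumes "2 \<le> b" "c < b"
  shows "digit_sum b c = c"
  using assms by (simp add: digit_sum_rec[of b c])

lemma digit_sum_shift_add:
  assumes "2 \<le> b" "x < b ^ t"
  shows "digit_sum b (y * b ^ t + x) = digit_sum b y + digit_sum b x"
  using assms(2)
proof (induction t arbitrary: x)
  case 0
  then show ?case by simp
next
  case (Suc t)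
  have eq: "y * b ^ Suc t + x = x + b * (y * b ^ t)"
    by (simp add: algebra_simps)
  have m: "(y * b ^ Suc t + x) mod b = x mod b"
    unfolding eq by simp
  have d: "(y * b ^ Suc t + x) div b = y * b ^ t + x div b"
    unfolding eq using assms(1) by simp
  have "x div b < b ^ t"
    using Suc.prems by (simp add: less_mult_imp_div_less mult.commute)
  then have "digit_sum b (y * b ^ t + x div b) = digit_sum b y + digit_sum b (x div b)"
    by (rule Suc.IH)
  then show ?case
    unfolding digit_sum_rec[OF assms(1), of "y * b ^ Suc t + x"]
    unfolding digit_sum_rec[OF assms(1), of x] m d by simp
qed

text \<open>All \<open>t\<close> digits of \<open>b ^ t - 1\<close> equal \<open>b - 1\<close>, so
  subtracting \<open>c\<close> needs no borrow: each digit is replaced by its difference from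
  \<open>b - 1\<close>, with \<open>c\<close> padded by zeros to length \<open>t\<close>.\<close>

lemma digit_sum_complement:
  assumes "2 \<le> b" "c < b ^ t"
  shows "digit_sum b (b ^ t - 1 - c) + digit_sum b c = t * (b - 1)"
  using assms(2)
proof (induction t arbitrary: c)
  case 0
  then show ?case by simp
next
  case (Suc t)
  have lt: "c div b < b ^ t"
    using Suc.prems by (simp add: less_mult_imp_div_less mult.commute)
  have cm: "c mod b < b"
    using assms(1) by simp
  \<comment> \<open>\<open>e\<close> and \<open>f\<close> are the complements
    \<open>b ^ t - 1 - c div b\<close> and \<open>b - 1 - c mod b\<close>, introduced through sums
    to keep truncated subtraction out of the arithmetic.\<close>
  obtain e where e: "b ^ t = c div b + 1 + e"
    using less_iff_Suc_add[of "c div b" "b ^ t"] lt by auto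
  obtain f where f: "b = c mod b + 1 + f"
    using less_iff_Suc_add[of "c mod b" b] cm by auto
  have "b ^ Suc t = b * (c div b) + b + b * e"
    by (simp add: e algebra_simps)
  also have "\<dots> = (c + 1 + f) + b * e"
    using f mult_div_mod_eq[of b c] by linarith
  finally have eq: "b ^ Suc t - 1 - c = f + b * e"
    by simp
  have "f < b" using f by linarith
  have "digit_sum b e + digit_sum b (c div b) = t * (b - 1)"
    using Suc.IH[OF lt] e by simp
  moreover have "digit_sum b (f + b * e) = f + digit_sum b e"
    using \<open>f < b\<close> assms(1) by (simp add: digit_sum_rec[of b "f + b * e"])
  moreover have "digit_sum b c = c mod b + digit_sum b (c div b)"
    by (rule digit_sum_rec[OF assms(1)])
  moreover have "b - 1 = c mod b + f" using f by linarith
  ultimately show ?case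
    unfolding eq by simp
qed

text \<open>Blocks below \<open>b ^ t\<close> do not overlap. The induction peels off the lowest
  block, because what remains is then a multiple of \<open>b ^ t\<close>.\<close>

lemma digit_sum_blocks:
  assumes "2 \<le> b" "\<And>i. i < r \<Longrightarrow> a i < b ^ t"
  shows "digit_sum b (\<Sum>i<r. a i * (b ^ t) ^ i) = (\<Sum>i<r. digit_sum b (a i))"
  using assms(2)
proof (induction r arbitrary: a)
  case 0
  then show ?case by simp
next
  case (Suc r)
  have "(\<Sum>i<Suc r. a i * (b ^ t) ^ i) = (\<Sum>i<r. a (Suc i) * (b ^ t) ^ i) * b ^ t + a 0"
    unfolding sum.lessThan_Suc_shift by (simp add: sum_distrib_left algebra_simps)
  then have "digit_sum b (\<Sum>i<Suc r. a i * (b ^ t) ^ i)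
      = digit_sum b (\<Sum>i<r. a (Suc i) * (b ^ t) ^ i) + digit_sum b (a 0)"
    using digit_sum_shift_add[OF assms(1), of "a 0" t] Suc.prems[of 0] by simp
  also have "digit_sum b (\<Sum>i<r. a (Suc i) * (b ^ t) ^ i) = (\<Sum>i<r. digit_sum b (a (Suc i)))"
    by (rule Suc.IH) (use Suc.prems in auto)
  finally show ?case
    unfolding sum.lessThan_Suc_shift by simp
qed

section \<open>The binomial expansion of an odd power, in pairs of terms\<close>

lemma sum_lessThan_double:
  fixes f :: "nat \<Rightarrow> 'a::comm_monoid_add"
  shows "(\<Sum>j<2 * r. f j) = (\<Sum>i<r. f (2 * i) + f (2 * i + 1))"
  by (induction r) (simp_all add: add.assoc)

text \<open>As \<open>n\<close> is odd, the \<open>n + 1\<close> terms pair up completely, and the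
  terms of odd index are the positive ones. Working over \<open>int\<close> accommodates the
  alternating signs.\<close>

lemma power_diff_one_blocks:
  fixes B :: int
  assumes "n + 1 = 2 * r"
  shows "(B - 1) ^ n
    = (\<Sum>i<r. (int (n choose (2 * i + 1)) * B - int (n choose (2 * i))) * (B\<^sup>2) ^ i)"
proof -
  have "(B - 1) ^ n = (\<Sum>j\<le>n. of_nat (n choose j) * B ^ j * (- 1) ^ (n - j))"
    using binomial_ring[of B "-1" n] by simp
  also have "{..n} = {..<2 * r}"
    using assms by auto
  also have "(\<Sum>j<2 * r. of_nat (n choose j) * B ^ j * (- 1) ^ (n - j)) =
      (\<Sum>i<r. int (n choose (2 * i)) * B ^ (2 * i) * (- 1) ^ (n - 2 * i)
        + int (n choose (2 * i + 1)) * B ^ (2 * i + 1) * (- 1) ^ (n - (2 * i + 1)))"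
    by (rule sum_lessThan_double)
  also have "\<dots> = (\<Sum>i<r. (int (n choose (2 * i + 1)) * B - int (n choose (2 * i))) * (B\<^sup>2) ^ i)"
  proof (rule sum.cong)
    fix i assume "i \<in> {..<r}"
    then have "n - 2 * i = 2 * (r - 1 - i) + 1" "n - (2 * i + 1) = 2 * (r - 1 - i)"
      using assms by auto
    then have "odd (n - 2 * i)" "even (n - (2 * i + 1))"
      by simp_all
    then show "int (n choose (2 * i)) * B ^ (2 * i) * (- 1) ^ (n - 2 * i)
        + int (n choose (2 * i + 1)) * B ^ (2 * i + 1) * (- 1) ^ (n - (2 * i + 1))
        = (int (n choose (2 * i + 1)) * B - int (n choose (2 * i))) * (B\<^sup>2) ^ i"
      by (simp add: algebra_simps flip: power_mult)
  qed simp
  finally show ?thesis .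
qed

lemma sum_choose_even_eq_odd:
  assumes "n + 1 = 2 * r" "0 < n"
  shows "(\<Sum>i<r. n choose (2 * i)) = (\<Sum>i<r. n choose (2 * i + 1))"
proof -
  have "(\<Sum>j\<le>n. (- 1) ^ j * int (n choose j)) = 0"
    using choose_alternating_sum[OF assms(2), where 'a = int] by simp
  also have "{..n} = {..<2 * r}"
    using assms by auto
  finally have "(\<Sum>i<r. int (n choose (2 * i)) - int (n choose (2 * i + 1))) = 0"
    by (simp add: sum_lessThan_double)
  then show ?thesis
    by (simp add: sum_subtractf flip: of_nat_sum)
qed

text \<open>For odd \<open>n\<close> the two middle coefficients agree by symmetry, so the maximum
  at \<open>n div 2\<close> is also attained at \<open>(n + 1) div 2\<close>.\<close>

lemma choose_le_central:
  assumes "odd n"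
  shows "n choose j \<le> n choose ((n + 1) div 2)"
proof -
  have "n - (n + 1) div 2 = n div 2" "(n + 1) div 2 \<le> n"
    using assms by presburger+
  then have "n choose ((n + 1) div 2) = n choose (n div 2)"
    using binomial_symmetric[of "(n + 1) div 2" n] by simp
  then show ?thesis
    using binomial_maximum[of n j] by simp
qed

section \<open>The digit sum of a power of \<open>b ^ t - 1\<close>\<close>

text \<open>Since \<open>d\<close> is positive, one unit is borrowed from \<open>c\<close>: the
  upper part becomes \<open>c - 1\<close> and the lower part the complement of \<open>d - 1\<close>.
  Both \<open>c - 1\<close> and \<open>d - 1\<close> are single digits even if \<open>c\<close> or
  \<open>d\<close> equals \<open>b\<close>, so the non-strict bounds suffice.\<close>

lemma digit_sum_block:
  assumes "2 \<le> b" "0 < c" "c \<le> b" "0 < d" "d \<le> b" "1 \<le> t"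
  shows "c * b ^ t - d < b ^ (2 * t)"
    and "digit_sum b (c * b ^ t - d) + d = c + t * (b - 1)"
proof -
  have bt: "b \<le> b ^ t"
    using assms(1,6) self_le_power[of b t] by simp
  have "c * b ^ t \<le> b ^ t * b ^ t"
    using assms(3) bt by (intro mult_right_mono) auto
  moreover have "0 < c * b ^ t"
    using assms(1,2) by simp
  moreover have "b ^ (2 * t) = b ^ t * b ^ t"
    by (simp add: power_add mult_2)
  ultimately show "c * b ^ t - d < b ^ (2 * t)"
    using assms(4) by linarith
  have d1: "d - 1 < b" "d - 1 < b ^ t"
    using assms bt by linarith+
  obtain c' where c': "c = Suc c'"
    using assms(2) gr0_conv_Suc by blast
  have eq: "c * b ^ t - d = (c - 1) * b ^ t + (b ^ t - 1 - (d - 1))"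
    using assms(4,5) bt by (simp add: c')
  have "digit_sum b (c * b ^ t - d) = digit_sum b (c - 1) + digit_sum b (b ^ t - 1 - (d - 1))"
    unfolding eq by (rule digit_sum_shift_add) (use assms(1) in auto)
  moreover have "digit_sum b (c - 1) = c - 1"
    using assms by (intro digit_sum_less_base) auto
  moreover have "digit_sum b (b ^ t - 1 - (d - 1)) + (d - 1) = t * (b - 1)"
    using digit_sum_complement[OF assms(1) d1(2)] digit_sum_less_base[OF assms(1) d1(1)] by simp
  ultimately show "digit_sum b (c * b ^ t - d) + d = c + t * (b - 1)"
    using assms(2,4) by linarith
qed

lemma digit_sum_power_diff_one:
  assumes "2 \<le> b" "1 \<le> t" "n + 1 = 2 * r" "n choose ((n + 1) div 2) \<le> b"
  shows "digit_sum b ((b ^ t - 1) ^ n) = r * (t * (b - 1))"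
proof -
  define a where "a i = (n choose (2 * i + 1)) * b ^ t - (n choose (2 * i))" for i
  have n: "odd n" "0 < n"
    using assms(3) by presburger+
  have c: "0 < n choose (2 * i)" "0 < n choose (2 * i + 1)" if "i < r" for i
    using that assms(3) by (simp_all del: binomial_Suc_n)
  have le: "n choose j \<le> b" for j
    using choose_le_central[OF n(1), of j] assms(4) by linarith
  have blocks: "a i < b ^ (2 * t)"
      "digit_sum b (a i) + (n choose (2 * i)) = (n choose (2 * i + 1)) + t * (b - 1)" if "i < r" for i
    unfolding a_def using digit_sum_block[OF assms(1) c(2)[OF that] le c(1)[OF that] le assms(2)] by auto
  \<comment> \<open>The truncated subtraction in \<open>a\<close> is a true one, which allows the
    transfer of the integer expansion to \<open>nat\<close>.\<close>
  have int_a: "int (a i) = int (n choose (2 * i + 1)) * int b ^ t - int (n choose (2 * i))"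
    if "i < r" for i
  proof -
    have "n choose (2 * i) \<le> b ^ t"
      using le[of "2 * i"] self_le_power[of b t] assms(1,2) by linarith
    also have "\<dots> \<le> (n choose (2 * i + 1)) * b ^ t"
      using mult_right_mono[of 1 "n choose (2 * i + 1)" "b ^ t"] c(2)[OF that] by linarith
    finally show ?thesis
      by (simp add: a_def of_nat_diff)
  qed
  have "int ((b ^ t - 1) ^ n) = (int b ^ t - 1) ^ n"
    using assms(1) by (simp add: of_nat_diff)
  also have "\<dots> = (\<Sum>i<r. int (a i) * ((int b ^ t)\<^sup>2) ^ i)"
    unfolding power_diff_one_blocks[OF assms(3)] by (intro sum.cong) (simp_all add: int_a)
  also have "\<dots> = int (\<Sum>i<r. a i * (b ^ (2 * t)) ^ i)"
    by (simp add: mult.commute flip: power_mult)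
  finally have "(b ^ t - 1) ^ n = (\<Sum>i<r. a i * (b ^ (2 * t)) ^ i)"
    by (simp only: of_nat_eq_iff)
  then have "digit_sum b ((b ^ t - 1) ^ n) = (\<Sum>i<r. digit_sum b (a i))"
    using digit_sum_blocks[OF assms(1), of r a "2 * t"] blocks(1) by simp
  moreover have "(\<Sum>i<r. digit_sum b (a i)) + (\<Sum>i<r. n choose (2 * i))
      = (\<Sum>i<r. n choose (2 * i + 1)) + r * (t * (b - 1))"
    using blocks(2) by (simp flip: sum.distrib) (simp add: sum.distrib)
  ultimately show ?thesis
    using sum_choose_even_eq_odd[OF assms(3) n(2)] by simp
qed

section \<open>Divisibility and the Niven property\<close>

text \<open>Each squaring contributes a factor \<open>b ^ 2 ^ k + 1\<close>, which is even for odd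
  \<open>b\<close>.\<close>

lemma two_power_dvd_power_diff_one:
  fixes b :: nat
  assumes "odd b"
  shows "2 ^ k * (b - 1) dvd b ^ 2 ^ k - 1"
proof (induction k)
  case 0
  then show ?case by simp
next
  case (Suc k)
  have "b ^ 2 ^ Suc k - 1 = (b ^ 2 ^ k + 1) * (b ^ 2 ^ k - 1)"
    by (simp add: power_add mult_2 algebra_simps)
  moreover have "2 dvd b ^ 2 ^ k + 1"
    using assms by simp
  ultimately show ?case
    using mult_dvd_mono[OF _ Suc.IH, of 2 "b ^ 2 ^ k + 1"] by (simp add: mult.assoc)
qed

lemma odd_part_decompose:
  fixes r :: nat
  assumes "0 < r"
  obtains q p where "odd p" "r = 2 ^ q * p"
proof -
  have "\<exists>q p. odd p \<and> r = 2 ^ q * p"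
    using assms
  proof (induction r rule: less_induct)
    case (less r)
    show ?case
    proof (cases "even r")
      case True
      then obtain s where s: "r = 2 * s" by blast
      with less.prems have "s < r" "0 < s" by simp_all
      with less.IH obtain q p where "odd p" "s = 2 ^ q * p" by blast
      with s have "odd p \<and> r = 2 ^ Suc q * p" by simp
      then show ?thesis by blast
    next
      case False
      then have "odd r \<and> r = 2 ^ 0 * r" by simp
      then show ?thesis by blast
    qed
  qed
  with that show thesis by blast
qed

text \<open>The condition on \<open>b\<close> is a divisibility so that both claims of the theorem
  can use it: the first with \<open>b - 1 = 2 * p * (2 * l + 1)\<close>, the second with
  \<open>b - 1 = 2 * p * z\<close>.\<close>

lemma degree_niven_power_diff_one:
  assumes "odd p" "n + 1 = 2 * (2 ^ q * p)" "n choose ((n + 1) div 2) \<le> b"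
    and "2 \<le> b" "2 * p dvd b - 1"
  shows "degree_niven n b (b ^ 2 ^ k - 1)"
proof -
  let ?N = "b ^ 2 ^ k - 1"
  have "even (b - 1)"
    using assms(5) dvd_mult_left by blast
  then have "odd b"
    using assms(4) by simp
  then have dvdN: "2 ^ k * (b - 1) dvd ?N"
    by (rule two_power_dvd_power_diff_one)
  have pos: "0 < ?N"
    using assms(4) one_less_power[of b "2 ^ k"] by simp
  have "digit_sum b ?N = 2 ^ k * (b - 1)"
    using digit_sum_complement[of b 0 "2 ^ k"] assms(4) by simp
  then have "niven b ?N"
    using dvdN pos by (simp add: niven_def)
  moreover have "niven b (?N ^ n)"
  proof -
    have n: "n = Suc (n - 1)"
      using assms(1,2) by presburger
    have "2 * p dvd ?N"
      by (rule dvd_trans[OF dvd_mult[OF assms(5)] dvdN])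
    then have "(2 * p) ^ (n - 1) dvd ?N ^ (n - 1)"
      by (rule dvd_power_same)
    \<comment> \<open>From \<open>2 ^ q \<le> n\<close> follows \<open>q \<le> n - 1\<close>, which
      handles the power of two. The factor \<open>p\<close> needs a positive exponent, hence the
      separate case \<open>n = 1\<close>, where \<open>2 ^ q * p = 1\<close>.\<close>
    moreover have "2 ^ q * p dvd (2 * p) ^ (n - 1)"
    proof (cases "n = 1")
      case True
      then have "2 ^ q * p = 1"
        using assms(2) by linarith
      then show ?thesis by simp
    next
      case False
      have "2 ^ q \<le> 2 ^ q * p"
        using assms(1) by (cases p) auto
      also have "\<dots> \<le> n"
        using assms(2) n by linarith
      finally have "q < n"
        using less_exp[of q] by linarith
      then have "(2::nat) ^ q dvd 2 ^ (n - 1)"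
        by (intro le_imp_power_dvd) simp
      moreover have "p dvd p ^ (n - 1)"
        using False n by (intro dvd_power) auto
      ultimately show ?thesis
        by (simp add: power_mult_distrib mult_dvd_mono)
    qed
    ultimately have "2 ^ q * p dvd ?N ^ (n - 1)"
      by (meson dvd_trans)
    then have "(2 ^ q * p) * (2 ^ k * (b - 1)) dvd ?N ^ (n - 1) * ?N"
      using dvdN by (rule mult_dvd_mono)
    moreover have "?N ^ (n - 1) * ?N = ?N ^ n"
      using power_Suc2[of ?N "n - 1"] n by simp
    moreover have "digit_sum b (?N ^ n) = (2 ^ q * p) * (2 ^ k * (b - 1))"
      by (rule digit_sum_power_diff_one) (use assms in auto)
    ultimately show ?thesis
      using pos by (simp add: niven_def)
  qed
  ultimately show ?thesis
    by (simp add: degree_niven_def)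
qed

section \<open>Nonzero digits and infinitely many bases\<close>

lemma base_digits_power_diff_one:
  assumes "2 \<le> b"
  shows "base_digits b (b ^ t - 1) = replicate t (b - 1)"
proof (induction t)
  case 0
  then show ?case by (simp add: base_digits.simps)
next
  case (Suc t)
  have "b * b ^ t = b + b * (b ^ t - 1)"
    using assms by (simp add: algebra_simps)
  then have eq: "b ^ Suc t - 1 = (b - 1) + b * (b ^ t - 1)"
    using assms by simp
  have "((b - 1) + b * y) mod b = b - 1" "((b - 1) + b * y) div b = y" "(b - 1) + b * y \<noteq> 0" for y
    using assms by (simp_all del: Nat.add_diff_assoc2)
  then show ?case
    unfolding eq base_digits.simps[of b "b - 1 + b * (b ^ t - 1)"] using assms Suc.IH by simp
qed

theorem theorem2:
  shows "(\<forall>b k n p q l :: nat.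
            2 \<le> b \<longrightarrow> 1 \<le> k \<longrightarrow> 1 \<le> n \<longrightarrow>
            odd p \<longrightarrow> n + 1 = 2 * (2 ^ q * p) \<longrightarrow>
            n choose ((n + 1) div 2) \<le> b \<longrightarrow>
            b = (4 * l + 2) * p + 1 \<longrightarrow>
            degree_niven n b (b ^ (2 ^ k) - 1))
       \<and> (\<forall>m :: nat. 1 \<le> m \<longrightarrow> odd m \<longrightarrow>
            infinite {b :: nat. 2 \<le> b \<and>
              (\<exists>N. degree_niven m b N \<and> (\<forall>d \<in> set (base_digits b N). d \<noteq> 0))})"
proof (intro conjI allI impI)
  fix b k n p q l :: nat
  assume asms: "odd p" "n + 1 = 2 * (2 ^ q * p)" "n choose ((n + 1) div 2) \<le> b" "2 \<le> b"
    and b: "b = (4 * l + 2) * p + 1"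
  have "b - 1 = 2 * p * (2 * l + 1)"
    using b by (simp add: algebra_simps)
  then have "2 * p dvd b - 1"
    by (rule dvdI)
  with asms show "degree_niven n b (b ^ (2 ^ k) - 1)"
    by (rule degree_niven_power_diff_one)
next
  fix m :: nat
  assume "1 \<le> m" "odd m"
  then obtain r where r: "m + 1 = 2 * r" "r \<noteq> 0"
    by (metis add_is_0 even_plus_one_iff evenE mult_0_right one_neq_zero)
  obtain q p where qp: "odd p" "r = 2 ^ q * p"
    using odd_part_decompose[of r] r(2) by blast
  let ?S = "{b :: nat. 2 \<le> b \<and>
    (\<exists>N. degree_niven m b N \<and> (\<forall>d \<in> set (base_digits b N). d \<noteq> 0))}"
  let ?K = "m choose ((m + 1) div 2)"
  show "infinite ?S"
    unfolding infinite_nat_iff_unbounded_le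
  proof
    fix x :: nat
    \<comment> \<open>This choice puts the base \<open>2 * p * z + 1\<close> above both
      \<open>x\<close>, for unboundedness, and \<open>?K\<close>, for the binomial bound. The
      exponent \<open>2 ^ 1\<close> below is just one admissible choice.\<close>
    define z where "z = x + ?K + 1"
    let ?b = "2 * p * z + 1"
    have "z \<le> 2 * p * z"
      using qp(1) by (cases p) auto
    then have b: "2 \<le> ?b" "x \<le> ?b" "?K \<le> ?b"
      unfolding z_def by simp_all
    have "degree_niven m ?b (?b ^ 2 ^ 1 - 1)"
      by (rule degree_niven_power_diff_one[OF qp(1) _ b(3,1)]) (use r qp in auto)
    moreover have "\<forall>d \<in> set (base_digits ?b (?b ^ 2 ^ 1 - 1)). d \<noteq> 0"
      unfolding base_digits_power_diff_one[OF b(1)] using b(1) by auto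
    ultimately show "\<exists>y\<ge>x. y \<in> ?S"
      using b(1,2) by blast
  qed
qed

end
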